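(* Let $\mathbf n=(n_k)_{k\ge1}$ and $\mathbf s=(s_k)_{k\ge1}$ be strictly increasing sequences of positive integers, and let $\mathcal B$ be a basis of a Banach space $X$ that is both Schauder and $\mathbf n$-Schauder. If $\mathbf s$ has bounded quotient gaps, then $\mathcal B$ is $\mathbf s$-($\mathbf n$, strong partially greedy) if and only if $\mathcal B$ is quasi-greedy and $\mathbf s$-order-($\mathbf n$, superconservative).
   Context: $X$ is a separable infinite-dimensional Banach space over $\mathbb F=\mathbb R$ or $\mathbb C$; $\mathbb N=\{1,2,\dots\}$. A basis of $X$ is a sequence $\mathcal B=(e_n)_{n\ge1}\subset X$ whose linear span is norm-dense and for which there is a sequence $(e_n^* )_{n\ge1}\subset X^*$ with $e_j^*(e_k)=\delta_{j,k}$ and $0<\inf_n\{\|e_n\|,\|e_n^*\|\}\le\sup_n\{\|e_n\|,\|e_n^*\|\}<\infty$. It is Markushevich if moreover the span of $(e_n^* )$ is weak$^*$-dense in $X^*$; it is Schauder if it is Markushevich and there is $K$ with $\|\sum_{n=1}^me_n^*(x)e_n\|\le K\|x\|$ for all $x\in X$, $m\in\mathbb N$. Sequences are identified with their sets of terms. Put $P^{\mathbf n}_0(x)=0$, $P^{\mathbf n}_k(x)=\sum_{i=1}^k e_{n_i}^*(x)e_{n_i}$. $\mathcal B$ is $\mathbf n$-Schauder if there is $C>0$ with $\|P^{\mathbf n}_m(x)\|\le C\|x\|$ for all $x\in X$, $m\in\mathbb N$. For finite $A\subset\mathbb N$, $P_A(x)=\sum_{n\in A}e_n^*(x)e_n$.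 For $x\in X$, $m\in\mathbb N$, a greedy set of $x$ of order $m$ is a set $A\subset\mathbb N$ with $|A|=m$ and $\min_{n\in A}|e_n^*(x)|\ge\max_{n\notin A}|e_n^*(x)|$; $G_m(x)$ denotes $P_A(x)$ for such an $A$ (not necessarily unique). Put $\widehat\sigma^{\mathbf n}_m(x)=\min_{0\le k\le m}\|x-P^{\mathbf n}_k(x)\|$. $\mathbf s$ has bounded quotient gaps if there is an integer $\ell\ge2$ with $\sup_k s_{k+1}/s_k\le\ell$. $\mathcal B$ is $\mathbf s$-($\mathbf n$, strong partially greedy) if there is $C\ge1$ with $\|x-G_m(x)\|\le C\,\widehat\sigma^{\mathbf n}_m(x)$ for all $x\in X$, all $m\in\mathbf s$ and all choices of $G_m(x)$. $\mathcal B$ is quasi-greedy if there is $C>0$ with $\|G_m(x)\|\le C\|x\|$ for all $x\in X$, all $m\in\mathbb N$ and all choices of $G_m(x)$. $A<B$ means $a<b$ for all $a\in A,b\in B$ (vacuous if one is empty), with numbers treated as singletons; similarly $A\le N$. Let $\mathbb T(\mathbf n,\mathbf s)$ be the collection of ordered pairs $(A,B)$ of finite subsets of $\mathbb N$ with $A\subset\mathbf n$, $|A|\le|B|$ and $A\le n_s<B\cap\mathbf n$ for some $s\in\mathbf s$. A sign is a sequence of scalars of modulus $1$; $1_{\varepsilon A}=\sum_{n\in A}\varepsilon_ne_n$. $\mathcal B$ is $\mathbf s$-order-($\mathbf n$, superconservative) if there is $C>0$ with $\|1_{\varepsilon A}\|\le C\|1_{\delta B}\|$ for all $(A,B)\in\mathbb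 T(\mathbf n,\mathbf s)$ and all signs $\varepsilon,\delta$. *)

theory Defs
  imports "HOL-Analysis.Analysis"
begin

text \<open>
  The scalar field, \<open>\<real>\<close> or \<open>\<complex>\<close>: up to isometric isomorphism these are the only two
  instances of the class.
\<close>

class real_or_complex = real_normed_field +
  assumes real_or_complex: "\<exists>\<phi> :: 'a \<Rightarrow> complex.
    (\<forall>a b. \<phi> (a + b) = \<phi> a + \<phi> b) \<and> (\<forall>a b. \<phi> (a * b) = \<phi> a * \<phi> b) \<and>
    (\<forall>a. norm (\<phi> a) = norm a) \<and> (range \<phi> = \<real> \<or> range \<phi> = UNIV)"

instance real :: real_or_complex
proof
  show "\<exists>\<phi> :: real \<Rightarrow> complex.
    (\<forall>a b. \<phi> (a + b) = \<phi> a + \<phi> b) \<and> (\<forall>a b. \<phi> (a * b) = \<phi> a * \<phi> b) \<and>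
    (\<forall>a. norm (\<phi> a) = norm a) \<and> (range \<phi> = \<real> \<or> range \<phi> = UNIV)"
    by (rule exI[of _ of_real]) (simp add: Reals_def)
qed

instance complex :: real_or_complex
proof
  show "\<exists>\<phi> :: complex \<Rightarrow> complex.
    (\<forall>a b. \<phi> (a + b) = \<phi> a + \<phi> b) \<and> (\<forall>a b. \<phi> (a * b) = \<phi> a * \<phi> b) \<and>
    (\<forall>a. norm (\<phi> a) = norm a) \<and> (range \<phi> = \<real> \<or> range \<phi> = UNIV)"
    by (rule exI[of _ id]) simp
qed

text \<open>
  A separable infinite-dimensional Banach space over the scalar field. The type
  carries the norm and the underlying real Banach space; \<open>smul\<close> is the scalar
  multiplication, whose restriction to the reals has to be the given \<open>scaleR\<close>.
\<close>

locale separable_inf_dim_banach = vector_space smul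
  for smul :: "'f::real_or_complex \<Rightarrow> 'a::banach \<Rightarrow> 'a" +
  assumes norm_scale: "norm (smul c x) = norm c * norm x"
    and scale_of_real: "smul (of_real r) x = r *\<^sub>R x"
    and separable: "separable_space (euclidean :: 'a topology)"
    and inf_dim: "\<not> (\<exists>D. finite D \<and> span D = UNIV)"

definition dual_space :: "('f::real_or_complex \<Rightarrow> 'a::banach \<Rightarrow> 'a) \<Rightarrow> ('a \<Rightarrow> 'f) set" where
  "dual_space smul = {f. bounded_linear f \<and> (\<forall>c x. f (smul c x) = c * f x)}"

text \<open>
  Sequences indexed by \<open>1, 2, \<dots>\<close> are functions on \<open>nat\<close> whose value at \<open>0\<close> is
  irrelevant. The functionals \<open>f n\<close> are the coordinate functionals of the basis \<open>e\<close>;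
  they are uniquely determined by \<open>e\<close>, because \<open>e\<close> has dense span.
\<close>

definition is_basis ::
  "('f::real_or_complex \<Rightarrow> 'a::banach \<Rightarrow> 'a) \<Rightarrow> (nat \<Rightarrow> 'a) \<Rightarrow> (nat \<Rightarrow> 'a \<Rightarrow> 'f) \<Rightarrow> bool" where
  "is_basis smul e f \<longleftrightarrow>
     closure (module.span smul (e ` {1..})) = UNIV \<and>
     (\<forall>n\<ge>1. f n \<in> dual_space smul) \<and>
     (\<forall>j\<ge>1. \<forall>k\<ge>1. f j (e k) = (if j = k then 1 else 0)) \<and>
     (let N = (\<lambda>n. norm (e n)) ` {1..} \<union> (\<lambda>n. onorm (f n)) ` {1..}
      in 0 < Inf N \<and> bdd_above N)"

text \<open>
  The topology on functions \<open>'a \<Rightarrow> 'f\<close> is the one of pointwise convergence; on the dual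
  space it induces the weak* topology.
\<close>

definition markushevich_basis ::
  "('f::real_or_complex \<Rightarrow> 'a::banach \<Rightarrow> 'a) \<Rightarrow> (nat \<Rightarrow> 'a) \<Rightarrow> (nat \<Rightarrow> 'a \<Rightarrow> 'f) \<Rightarrow> bool" where
  "markushevich_basis smul e f \<longleftrightarrow>
     is_basis smul e f \<and>
     top_of_set (dual_space smul) closure_of
       {\<lambda>x. \<Sum>n\<in>A. c n * f n x | A c. finite A \<and> A \<subseteq> {1..}} = dual_space smul"

definition coord_proj ::
  "('f::real_or_complex \<Rightarrow> 'a::banach \<Rightarrow> 'a) \<Rightarrow> (nat \<Rightarrow> 'a) \<Rightarrow> (nat \<Rightarrow> 'a \<Rightarrow> 'f) \<Rightarrow> nat set \<Rightarrow> 'a \<Rightarrow> 'a" where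
  "coord_proj smul e f A x = (\<Sum>n\<in>A. smul (f n x) (e n))"

definition partial_sum ::
  "('f::real_or_complex \<Rightarrow> 'a::banach \<Rightarrow> 'a) \<Rightarrow> (nat \<Rightarrow> 'a) \<Rightarrow> (nat \<Rightarrow> 'a \<Rightarrow> 'f) \<Rightarrow>
   (nat \<Rightarrow> nat) \<Rightarrow> nat \<Rightarrow> 'a \<Rightarrow> 'a" where
  "partial_sum smul e f n k x = (\<Sum>i=1..k. smul (f (n i) x) (e (n i)))"

definition schauder_basis ::
  "('f::real_or_complex \<Rightarrow> 'a::banach \<Rightarrow> 'a) \<Rightarrow> (nat \<Rightarrow> 'a) \<Rightarrow> (nat \<Rightarrow> 'a \<Rightarrow> 'f) \<Rightarrow> bool" where
  "schauder_basis smul e f \<longleftrightarrow>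
     markushevich_basis smul e f \<and>
     (\<exists>K. \<forall>x. \<forall>m\<ge>1. norm (\<Sum>n=1..m. smul (f n x) (e n)) \<le> K * norm x)"

definition n_schauder ::
  "('f::real_or_complex \<Rightarrow> 'a::banach \<Rightarrow> 'a) \<Rightarrow> (nat \<Rightarrow> 'a) \<Rightarrow> (nat \<Rightarrow> 'a \<Rightarrow> 'f) \<Rightarrow>
   (nat \<Rightarrow> nat) \<Rightarrow> bool" where
  "n_schauder smul e f n \<longleftrightarrow>
     (\<exists>C>0. \<forall>x. \<forall>m\<ge>1. norm (partial_sum smul e f n m x) \<le> C * norm x)"

definition greedy_set :: "(nat \<Rightarrow> 'a \<Rightarrow> 'f::real_or_complex) \<Rightarrow> 'a \<Rightarrow> nat \<Rightarrow> nat set \<Rightarrow> bool" where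
  "greedy_set f x m A \<longleftrightarrow>
     finite A \<and> A \<subseteq> {1..} \<and> card A = m \<and>
     (\<forall>i\<in>A. \<forall>j\<in>{1..} - A. norm (f j x) \<le> norm (f i x))"

definition sigma_hat ::
  "('f::real_or_complex \<Rightarrow> 'a::banach \<Rightarrow> 'a) \<Rightarrow> (nat \<Rightarrow> 'a) \<Rightarrow> (nat \<Rightarrow> 'a \<Rightarrow> 'f) \<Rightarrow>
   (nat \<Rightarrow> nat) \<Rightarrow> nat \<Rightarrow> 'a \<Rightarrow> real" where
  "sigma_hat smul e f n m x = Min ((\<lambda>k. norm (x - partial_sum smul e f n k x)) ` {0..m})"

definition bounded_quotient_gaps :: "(nat \<Rightarrow> nat) \<Rightarrow> bool" where
  "bounded_quotient_gaps s \<longleftrightarrow>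
     (\<exists>l::nat. l \<ge> 2 \<and> (\<forall>k\<ge>1. real (s (k + 1)) / real (s k) \<le> real l))"

definition strong_partially_greedy ::
  "('f::real_or_complex \<Rightarrow> 'a::banach \<Rightarrow> 'a) \<Rightarrow> (nat \<Rightarrow> 'a) \<Rightarrow> (nat \<Rightarrow> 'a \<Rightarrow> 'f) \<Rightarrow>
   (nat \<Rightarrow> nat) \<Rightarrow> (nat \<Rightarrow> nat) \<Rightarrow> bool" where
  "strong_partially_greedy smul e f s n \<longleftrightarrow>
     (\<exists>C\<ge>1. \<forall>x. \<forall>m\<in>s ` {1..}. \<forall>A. greedy_set f x m A \<longrightarrow>
        norm (x - coord_proj smul e f A x) \<le> C * sigma_hat smul e f n m x)"

definition quasi_greedy ::
  "('f::real_or_complex \<Rightarrow> 'a::banach \<Rightarrow> 'a) \<Rightarrow> (nat \<Rightarrow> 'a) \<Rightarrow> (nat \<Rightarrow> 'a \<Rightarrow> 'f) \<Rightarrow> bool" where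
  "quasi_greedy smul e f \<longleftrightarrow>
     (\<exists>C>0. \<forall>x. \<forall>m\<ge>1. \<forall>A. greedy_set f x m A \<longrightarrow>
        norm (coord_proj smul e f A x) \<le> C * norm x)"

definition T_pairs :: "(nat \<Rightarrow> nat) \<Rightarrow> (nat \<Rightarrow> nat) \<Rightarrow> (nat set \<times> nat set) set" where
  "T_pairs n s = {(A, B). finite A \<and> finite B \<and> A \<subseteq> {1..} \<and> B \<subseteq> {1..} \<and>
     A \<subseteq> n ` {1..} \<and> card A \<le> card B \<and>
     (\<exists>t\<in>s ` {1..}. (\<forall>a\<in>A. a \<le> n t) \<and> (\<forall>b\<in>B \<inter> n ` {1..}. n t < b))}"

definition is_sign :: "(nat \<Rightarrow> 'f::real_or_complex) \<Rightarrow> bool" where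
  "is_sign \<epsilon> \<longleftrightarrow> (\<forall>n\<ge>1. norm (\<epsilon> n) = 1)"

definition signed_indicator ::
  "('f::real_or_complex \<Rightarrow> 'a::banach \<Rightarrow> 'a) \<Rightarrow> (nat \<Rightarrow> 'a) \<Rightarrow> (nat \<Rightarrow> 'f) \<Rightarrow> nat set \<Rightarrow> 'a" where
  "signed_indicator smul e \<epsilon> A = (\<Sum>n\<in>A. smul (\<epsilon> n) (e n))"

definition order_superconservative ::
  "('f::real_or_complex \<Rightarrow> 'a::banach \<Rightarrow> 'a) \<Rightarrow> (nat \<Rightarrow> 'a) \<Rightarrow>
   (nat \<Rightarrow> nat) \<Rightarrow> (nat \<Rightarrow> nat) \<Rightarrow> bool" where
  "order_superconservative smul e s n \<longleftrightarrow>
     (\<exists>C>0. \<forall>(A, B)\<in>T_pairs n s. \<forall>\<epsilon> \<delta>. is_sign \<epsilon> \<and> is_sign \<delta> \<longrightarrow>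
        norm (signed_indicator smul e \<epsilon> A) \<le> C * norm (signed_indicator smul e \<delta> B))"

end

theory Submission
  imports Defs
begin

text \<open>
  Write \<open>P A\<close> for the coordinate projection onto \<open>A\<close> and \<open>D m\<close> for the set of the first \<open>m\<close>
  terms of \<open>n\<close>.

  \<^bold>\<open>From the greedy inequality to superconservativity.\<close> For a pair \<open>(A, B)\<close> separated at \<open>n t\<close> with
  \<open>t \<in> s\<close>, let \<open>B'\<close> be the initial segment of \<open>B\<close> with as many elements as \<open>A\<close>. Take a vector
  supported on \<open>D t \<union> B'\<close> whose coefficients are the given signs on \<open>A\<close> and \<open>B'\<close> and are \<open>1\<close>
  elsewhere. As all have the same modulus, \<open>(D t - A) \<union> B'\<close> is a greedy set, and its order is
  exactly \<open>t\<close>. Removing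
  it leaves the sign vector on \<open>A\<close>, while the competitor \<open>P (D t)\<close> leaves the one on \<open>B'\<close>, which is
  an initial partial sum of the one on \<open>B\<close>.

  \<^bold>\<open>From the greedy inequality to quasi-greediness.\<close> The zero competitor bounds the greedy
  projections whose order lies in \<open>s\<close>. Let \<open>t \<le> m \<le> l * t\<close> with \<open>t \<in> s\<close>. A greedy set of order
  \<open>m\<close> can be cut by intervals of \<open>\<nat>\<close> into at most \<open>l\<close> overlapping pieces of size exactly \<open>t\<close>. Each
  piece is a greedy set of the restriction of the vector to an interval, and such restrictions are
  uniformly bounded for a Schauder basis, which also removes the overlaps
  (\<open>greedy_proj_bound_multiples\<close>). Bounded quotient gaps provide such an \<open>l\<close> for all \<open>m\<close> beyond the
  first term of \<open>s\<close>, and smaller orders are handled term by term.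

  \<^bold>\<open>The converse.\<close> Let \<open>A\<close> be a greedy set of \<open>x\<close> of order \<open>m \<in> s\<close>, let \<open>k \<le> m\<close> and
  \<open>y = x - P (D k) x\<close>. Then \<open>x - P A x = y - P (A - D k) y + P (D k - A) x\<close>. The second term is a
  greedy projection of \<open>y\<close>. For the third, compare \<open>D k - A\<close> with \<open>A - D m\<close> rather than with
  \<open>A - D k\<close>: since \<open>D m\<close> and \<open>A\<close> both have \<open>m\<close> elements, \<open>A - D m\<close> is large enough, and the pair is
  separated at \<open>n m\<close> with \<open>m \<in> s\<close>. The two sets are linked through sign vectors, by convexity
  (\<open>norm_combination_le_signs\<close>) on \<open>D k - A\<close> and by an Abel summation
  (\<open>quasi_greedy_sign_bound\<close>) on \<open>A - D m\<close>; the \<open>n\<close>-Schauder property bounds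
  \<open>x - P (D m) x = y - P (D m) y\<close> by \<open>y\<close>.
\<close>

section \<open>Coordinate projections\<close>

lemma initial_segment_of_card:
  fixes A :: "nat set"
  assumes "finite A" "A \<subseteq> {1..}" "r \<le> card A"
  shows "\<exists>N. card (A \<inter> {1..N}) = r"
  using assms(3)
proof (induction r)
  case 0
  show ?case by (rule exI[of _ 0]) simp
next
  case (Suc r)
  then obtain N where N: "card (A \<inter> {1..N}) = r" by auto
  have "A - {1..N} \<noteq> {}"
  proof
    assume "A - {1..N} = {}"
    then have "A \<inter> {1..N} = A" by auto
    then show False using N Suc.prems by simp
  qed
  define b where "b = Min (A - {1..N})"
  have "b \<in> A - {1..N}"
    unfolding b_def using assms(1) \<open>A - {1..N} \<noteq> {}\<close> by (intro Min_in) simp_all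
  moreover have "\<forall>a\<in>A - {1..N}. b \<le> a"
    unfolding b_def using assms(1) by (intro ballI Min_le) simp_all
  ultimately have b: "b \<in> A - {1..N}" "\<forall>a\<in>A - {1..N}. b \<le> a" by blast+
  have pos: "a \<ge> 1" if "a \<in> A" for a using that assms(2) by auto
  have "b \<in> A" "N < b" using b(1) pos[of b] by auto
  have "A \<inter> {1..b} = insert b (A \<inter> {1..N})"
  proof (rule set_eqI)
    fix a
    show "a \<in> A \<inter> {1..b} \<longleftrightarrow> a \<in> insert b (A \<inter> {1..N})"
    proof (cases "a \<in> A \<and> N < a")
      case True
      then have "b \<le> a" using b(2) by simp
      then show ?thesis using True pos[of a] by auto
    next
      case False
      then show ?thesis using \<open>b \<in> A\<close> \<open>N < b\<close> pos[of b] by auto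
    qed
  qed
  moreover have "b \<notin> A \<inter> {1..N}" using b by auto
  ultimately have "card (A \<inter> {1..b}) = Suc r" using N assms(1) by simp
  then show ?case by blast
qed

text \<open>
  Indexing the Schauder bound by all \<open>m\<close>, including \<open>0\<close>, and taking \<open>K \<ge> 1\<close> lets every estimate
  below use it without side conditions.
\<close>

locale schauder_system = separable_inf_dim_banach smul
  for smul :: "'f::real_or_complex \<Rightarrow> 'a::banach \<Rightarrow> 'a" +
  fixes e :: "nat \<Rightarrow> 'a" and f :: "nat \<Rightarrow> 'a \<Rightarrow> 'f" and K :: real
  assumes dual: "k \<ge> 1 \<Longrightarrow> f k \<in> dual_space smul"
    and biorthogonal: "j \<ge> 1 \<Longrightarrow> k \<ge> 1 \<Longrightarrow> f j (e k) = (if j = k then 1 else 0)"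
    and K_ge_1: "K \<ge> 1"
    and schauder: "norm (coord_proj smul e f {1..m} x) \<le> K * norm x"
begin

text \<open>
  The coefficients of \<open>comb\<close> are arbitrary: both coordinate projections and sign vectors are
  instances.
\<close>

abbreviation comb :: "(nat \<Rightarrow> 'f) \<Rightarrow> nat set \<Rightarrow> 'a" where
  "comb \<equiv> signed_indicator smul e"

abbreviation P :: "nat set \<Rightarrow> 'a \<Rightarrow> 'a" where
  "P \<equiv> coord_proj smul e f"

lemma proj_eq_comb: "P A x = comb (\<lambda>k. f k x) A"
  by (simp add: coord_proj_def signed_indicator_def)

lemma coord_linear:
  assumes "k \<ge> 1"
  shows "f k (x + y) = f k x + f k y" "f k (x - y) = f k x - f k y"
    "f k (smul c x) = c * f k x" "f k (sum g A) = (\<Sum>i\<in>A. f k (g i))"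
proof -
  have "bounded_linear (f k)" and h: "\<And>c x. f k (smul c x) = c * f k x"
    using dual[OF assms] by (auto simp: dual_space_def)
  then have l: "linear (f k)" by (simp add: bounded_linear.linear)
  show "f k (x + y) = f k x + f k y" using l by (rule linear_add)
  show "f k (x - y) = f k x - f k y" using l by (rule linear_diff)
  show "f k (smul c x) = c * f k x" by (rule h)
  show "f k (sum g A) = (\<Sum>i\<in>A. f k (g i))" using l by (rule linear_sum)
qed

lemma coord_comb:
  assumes "finite A" "A \<subseteq> {1..}" "k \<ge> 1"
  shows "f k (comb a A) = (if k \<in> A then a k else 0)"
proof -
  have "f k (comb a A) = (\<Sum>i\<in>A. a i * f k (e i))"
    using assms by (simp add: signed_indicator_def coord_linear)
  also have "\<dots> = (\<Sum>i\<in>A. if k = i then a i else 0)"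
    by (rule sum.cong) (use assms in \<open>auto simp: biorthogonal\<close>)
  finally show ?thesis using assms by simp
qed

lemma coord_proj_coord:
  "finite A \<Longrightarrow> A \<subseteq> {1..} \<Longrightarrow> k \<ge> 1 \<Longrightarrow> f k (P A x) = (if k \<in> A then f k x else 0)"
  by (simp add: proj_eq_comb coord_comb)

lemma comb_cong: "(\<And>i. i \<in> A \<Longrightarrow> a i = b i) \<Longrightarrow> comb a A = comb b A"
  by (simp add: signed_indicator_def)

lemma comb_union:
  "finite A \<Longrightarrow> finite B \<Longrightarrow> A \<inter> B = {} \<Longrightarrow> comb a (A \<union> B) = comb a A + comb a B"
  by (simp add: signed_indicator_def sum.union_disjoint)

lemma comb_scale: "smul c (comb a A) = comb (\<lambda>i. c * a i) A"
  by (simp add: signed_indicator_def scale_sum_right)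

lemma proj_union:
  "finite A \<Longrightarrow> finite B \<Longrightarrow> A \<inter> B = {} \<Longrightarrow> P (A \<union> B) x = P A x + P B x"
  by (simp add: proj_eq_comb comb_union)

lemma proj_comb:
  assumes "finite A" "finite B" "A \<subseteq> {1..}" "B \<subseteq> {1..}"
  shows "P A (comb a B) = comb a (A \<inter> B)"
proof -
  have "P A (comb a B) = (\<Sum>i\<in>A. if i \<in> B then smul (a i) (e i) else 0)"
    unfolding coord_proj_def
    by (rule sum.cong) (use assms in \<open>auto simp: coord_comb\<close>)
  then show ?thesis
    using assms by (simp add: signed_indicator_def sum.inter_restrict)
qed

lemma proj_proj:
  "finite A \<Longrightarrow> finite B \<Longrightarrow> A \<subseteq> {1..} \<Longrightarrow> B \<subseteq> {1..} \<Longrightarrow> P A (P B x) = P (A \<inter> B) x"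
  by (subst (2 3) proj_eq_comb) (rule proj_comb)

lemma proj_diff: "A \<subseteq> {1..} \<Longrightarrow> P A (x - y) = P A x - P A y"
  unfolding coord_proj_def sum_subtractf[symmetric]
  by (rule sum.cong) (auto simp: coord_linear scale_left_diff_distrib)

lemma proj_remove:
  assumes "finite A" "finite F" "A \<subseteq> {1..}" "F \<subseteq> {1..}" "A \<inter> F = {}"
  shows "P A (x - P F x) = P A x"
  using assms by (simp add: proj_diff proj_proj) (simp add: coord_proj_def)

lemma norm_tail_le: "norm (x - P {1..N} x) \<le> (1 + K) * norm x"
  using norm_triangle_ineq4[of x "P {1..N} x"] schauder[of N x] by (simp add: algebra_simps)

lemma norm_proj_le_card:
  assumes "finite A" "A \<subseteq> {1..}"
  shows "norm (P A x) \<le> 2 * K * card A * norm x"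
proof -
  \<comment> \<open>A one-dimensional projection is a difference of consecutive partial sums.\<close>
  have single: "norm (smul (f i x) (e i)) \<le> 2 * K * norm x" if "i \<in> A" for i
  proof -
    have "{1..i} = {1..i - 1} \<union> {i}" using that assms by force
    then have "P {1..i} x = P {1..i - 1} x + P {i} x"
      using proj_union[of "{1..i - 1}" "{i}" x] that assms by force
    then have "smul (f i x) (e i) = P {1..i} x - P {1..i - 1} x"
      by (simp add: coord_proj_def)
    then show ?thesis
      using norm_triangle_ineq4[of "P {1..i} x" "P {1..i - 1} x"]
        schauder[of i x] schauder[of "i - 1" x] by simp
  qed
  have "norm (P A x) \<le> (\<Sum>i\<in>A. 2 * K * norm x)"
    unfolding coord_proj_def by (rule sum_norm_le) (rule single)
  then show ?thesis by (simp add: mult_ac)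
qed

section \<open>Greedy sets\<close>

lemma greedy_set_remove:
  assumes "greedy_set f x m A" "finite F" "F \<subseteq> {1..}"
  shows "greedy_set f (x - P F x) (card (A - F)) (A - F)"
proof -
  have c: "f k (x - P F x) = (if k \<in> F then 0 else f k x)" if "k \<ge> 1" for k
    using that assms by (simp add: coord_linear coord_proj_coord)
  show ?thesis
    using assms unfolding greedy_set_def
    by (force simp: c)
qed

lemma greedy_set_restrict:
  assumes "greedy_set f x m A" "finite F" "F \<subseteq> {1..}"
  shows "greedy_set f (P F x) (card (A \<inter> F)) (A \<inter> F)"
proof -
  have c: "f k (P F x) = (if k \<in> F then f k x else 0)" if "k \<ge> 1" for k
    using that assms by (simp add: coord_proj_coord)
  show ?thesis
    using assms unfolding greedy_set_def
    by (force simp: c)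
qed

text \<open>
  A greedy set of \<open>m > t\<close> elements is covered by its first \<open>t\<close> elements, a greedy set of an initial
  restriction of \<open>x\<close>, and its last \<open>max t (m - t)\<close> elements, a greedy set of a tail of \<open>x\<close> to which
  the induction hypothesis applies. Letting the two overlap keeps the size of the second at
  least \<open>t\<close>; a partial sum projection then cuts the overlap off. The constant is the same for
  all \<open>t\<close>, which is what makes the bound usable along the whole sequence \<open>s\<close>.
\<close>

lemma greedy_proj_bound_multiples:
  assumes bound: "\<And>t x A. t \<in> S \<Longrightarrow> greedy_set f x t A \<Longrightarrow> norm (P A x) \<le> C * norm x"
    and "C \<ge> 0"
  shows "\<exists>M\<ge>0. \<forall>t\<in>S. \<forall>x m A. greedy_set f x m A \<and> t \<le> m \<and> m \<le> Suc j * t \<longrightarrow>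
    norm (P A x) \<le> M * norm x"
proof (induction j)
  case 0
  have "m = t" if "t \<le> m" "m \<le> Suc 0 * t" for m t :: nat using that by simp
  then show ?case using bound \<open>C \<ge> 0\<close> by blast
next
  case (Suc j)
  then obtain M where "M \<ge> 0" and M: "\<And>t x m A. t \<in> S \<Longrightarrow> greedy_set f x m A \<Longrightarrow> t \<le> m \<Longrightarrow>
    m \<le> Suc j * t \<Longrightarrow> norm (P A x) \<le> M * norm x" by blast
  let ?M = "C * K + (1 + K) * (M * (1 + K))"
  have step: "norm (P A x) \<le> ?M * norm x"
    if t: "t \<in> S" and g: "greedy_set f x m A" and m: "t \<le> m" "m \<le> Suc (Suc j) * t" for t x m A
  proof -
    have A: "finite A" "A \<subseteq> {1..}" "card A = m" using g by (auto simp: greedy_set_def)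
    define r where "r = min t (m - t)"
    obtain N where N: "card (A \<inter> {1..N}) = t"
      using initial_segment_of_card[OF A(1,2), of t] A(3) m by auto
    have r_le: "r \<le> card A" using A(3) m by (simp add: r_def)
    obtain L where L: "card (A \<inter> {1..L}) = r"
      using initial_segment_of_card[OF A(1,2), of r] A(3) m r_le by blast
    have sub: "A \<inter> {1..L} \<subseteq> A \<inter> {1..N}"
    proof (cases "L \<le> N")
      case False
      then have "A \<inter> {1..N} \<subseteq> A \<inter> {1..L}" by auto
      moreover have "card (A \<inter> {1..L}) \<le> card (A \<inter> {1..N})" using N L by (simp add: r_def)
      ultimately have "A \<inter> {1..N} = A \<inter> {1..L}" using A by (intro card_seteq) auto
      then show ?thesis by simp
    qed auto
    have "norm (P (A \<inter> {1..N}) (P {1..N} x)) \<le> C * norm (P {1..N} x)"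
      by (rule bound[OF t]) (use greedy_set_restrict[OF g, of "{1..N}"] N in simp)
    also have "\<dots> \<le> C * (K * norm x)" using schauder \<open>C \<ge> 0\<close> by (rule mult_left_mono)
    also have "P (A \<inter> {1..N}) (P {1..N} x) = P (A \<inter> {1..N}) x"
      using A proj_proj[of "A \<inter> {1..N}" "{1..N}" x] by (simp add: Int_assoc le_infI1)
    finally have head: "norm (P (A \<inter> {1..N}) x) \<le> C * K * norm x" by (simp only: mult.assoc)
    define w where "w = P (A - {1..L}) x"
    have "card (A - {1..L}) = m - r"
      using L A by (simp add: card_Diff_subset_Int)
    moreover have "t \<le> m - r" "m - r \<le> Suc j * t" using m by (auto simp: r_def min_def)
    ultimately have "norm (P (A - {1..L}) (x - P {1..L} x)) \<le> M * norm (x - P {1..L} x)"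
      using greedy_set_remove[OF g, of "{1..L}"] M[OF t] by simp
    also have "\<dots> \<le> M * ((1 + K) * norm x)"
      using norm_tail_le \<open>M \<ge> 0\<close> by (rule mult_left_mono)
    also have "P (A - {1..L}) (x - P {1..L} x) = w"
      unfolding w_def using A by (intro proj_remove) auto
    finally have w: "norm w \<le> M * (1 + K) * norm x" by (simp only: mult.assoc)
    have "w = P ((A - {1..L}) \<inter> {1..N}) x + P (A - {1..N}) x"
    proof -
      have "(A - {1..L}) \<inter> {1..N} \<union> (A - {1..N}) = A - {1..L}" using sub by blast
      moreover have "P ((A - {1..L}) \<inter> {1..N} \<union> (A - {1..N})) x
          = P ((A - {1..L}) \<inter> {1..N}) x + P (A - {1..N}) x"
        using A(1) by (intro proj_union) auto
      ultimately show ?thesis unfolding w_def by (simp only:)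
    qed
    moreover have "P {1..N} w = P ((A - {1..L}) \<inter> {1..N}) x"
      unfolding w_def using A proj_proj[of "{1..N}" "A - {1..L}" x]
      by (simp add: Int_commute subset_eq)
    ultimately have "P (A - {1..N}) x = w - P {1..N} w" by simp
    then have "norm (P (A - {1..N}) x) \<le> (1 + K) * norm w" using norm_tail_le by simp
    also have "\<dots> \<le> (1 + K) * (M * (1 + K) * norm x)"
      using w K_ge_1 by (intro mult_left_mono) auto
    finally have tail: "norm (P (A - {1..N}) x) \<le> (1 + K) * (M * (1 + K) * norm x)" .
    have "P A x = P (A \<inter> {1..N}) x + P (A - {1..N}) x"
      using A(1) proj_union[of "A \<inter> {1..N}" "A - {1..N}" x]
      by (simp add: Int_Diff_Un Int_Diff_disjoint)
    then show ?thesis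
      using norm_triangle_ineq[of "P (A \<inter> {1..N}) x" "P (A - {1..N}) x"] head tail
      by (simp add: algebra_simps)
  qed
  have "?M \<ge> 0" using \<open>C \<ge> 0\<close> \<open>M \<ge> 0\<close> K_ge_1 by simp
  then show ?case
    by (intro exI[of _ ?M] conjI ballI allI impI; (elim conjE)?) (assumption | rule step)+
qed

section \<open>Sign vectors\<close>

text \<open>
  A nonzero scalar \<open>a\<close> of modulus \<open>r \<le> 1\<close> is \<open>(1 + r) / 2 * u + (1 - r) / 2 * (- u)\<close> with
  \<open>u = a / r\<close>, a convex combination of two unimodular scalars, over \<open>\<real>\<close> and \<open>\<complex>\<close> alike. Applying
  this coordinate by coordinate, a bound on all sign vectors passes to their convex hull; the
  offset \<open>y\<close> carries the coordinates already treated.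
\<close>

lemma norm_offset_combination_le_signs:
  assumes "finite A" "\<And>i. i \<in> A \<Longrightarrow> norm (a i) \<le> 1"
    and "\<And>\<epsilon>. is_sign \<epsilon> \<Longrightarrow> norm (y + comb \<epsilon> A) \<le> M"
  shows "norm (y + comb a A) \<le> M"
  using assms
proof (induction A arbitrary: y rule: finite_induct)
  case empty
  have "is_sign (\<lambda>_. 1 :: 'f)" by (simp add: is_sign_def)
  from empty(2)[OF this] show ?case by (simp add: signed_indicator_def)
next
  case (insert j A)
  define r where "r = norm (a j)"
  define u where "u = (if a j = 0 then 1 else a j / of_real r)"
  have r: "0 \<le> r" "r \<le> 1" using insert.prems(1)[of j] by (auto simp: r_def)
  have u: "norm u = 1" by (simp add: u_def r_def norm_divide)
  have au: "a j = of_real r * u" by (simp add: u_def r_def)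
  have ins: "comb b (insert j A) = smul (b j) (e j) + comb b A" for b
    using insert.hyps by (simp add: signed_indicator_def)
  have unit: "norm (y + smul v (e j) + comb a A) \<le> M" if v: "norm v = 1" for v
  proof (rule insert.IH)
    show "norm (a i) \<le> 1" if "i \<in> A" for i using that insert.prems by blast
    fix \<epsilon> :: "nat \<Rightarrow> 'f" assume "is_sign \<epsilon>"
    then have "is_sign (\<epsilon>(j := v))" using v by (simp add: is_sign_def)
    from insert.prems(2)[OF this]
    have "norm (y + (smul v (e j) + comb (\<epsilon>(j := v)) A)) \<le> M" unfolding ins by (simp only: fun_upd_same)
    moreover have "comb (\<epsilon>(j := v)) A = comb \<epsilon> A"
      using insert.hyps by (intro comb_cong) auto
    ultimately show "norm (y + smul v (e j) + comb \<epsilon> A) \<le> M" by (simp add: add.assoc)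
  qed
  define Y where "Y = y + comb a A"
  define p q where "p = Y + smul u (e j)" and "q = Y - smul u (e j)"
  have "norm p \<le> M" "norm q \<le> M"
    using unit[of u] unit[of "- u"] u by (simp_all add: p_def q_def Y_def algebra_simps)
  have convex: "b *\<^sub>R (Y + v) + c *\<^sub>R (Y - v) = (b + c) *\<^sub>R Y + (b - c) *\<^sub>R v" for b c v
    by (simp add: algebra_simps)
  have "(1 + r) / 2 + (1 - r) / 2 = 1" "(1 + r) / 2 - (1 - r) / 2 = r" by (simp_all add: field_simps)
  then have "((1 + r) / 2) *\<^sub>R p + ((1 - r) / 2) *\<^sub>R q = Y + r *\<^sub>R smul u (e j)"
    unfolding p_def q_def convex by simp
  moreover have "r *\<^sub>R smul u (e j) = smul (a j) (e j)"
    by (simp add: au scale_of_real[symmetric])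
  ultimately have "y + comb a (insert j A) = ((1 + r) / 2) *\<^sub>R p + ((1 - r) / 2) *\<^sub>R q"
    by (simp add: ins Y_def add_ac)
  also have "norm \<dots> \<le> (1 + r) / 2 * norm p + (1 - r) / 2 * norm q"
    using r by (intro order.trans[OF norm_triangle_ineq]) simp
  also have "\<dots> \<le> (1 + r) / 2 * M + (1 - r) / 2 * M"
    using r \<open>norm p \<le> M\<close> \<open>norm q \<le> M\<close> by (intro add_mono mult_left_mono) auto
  also have "\<dots> = M" by (simp add: field_simps)
  finally show ?case .
qed

corollary norm_combination_le_signs:
  assumes "finite A" "\<alpha> > 0" "\<And>i. i \<in> A \<Longrightarrow> norm (a i) \<le> \<alpha>"
    and "\<And>\<epsilon>. is_sign \<epsilon> \<Longrightarrow> norm (comb \<epsilon> A) \<le> M"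
  shows "norm (comb a A) \<le> \<alpha> * M"
proof -
  have "norm (0 + comb (\<lambda>i. a i / of_real \<alpha>) A) \<le> M"
    by (rule norm_offset_combination_le_signs)
      (use assms in \<open>auto simp: norm_divide\<close>)
  moreover have "comb a A = smul (of_real \<alpha>) (comb (\<lambda>i. a i / of_real \<alpha>) A)"
    using assms(2) by (simp add: comb_scale)
  ultimately show ?thesis
    using assms(2) by (simp add: norm_scale)
qed

text \<open>
  Dividing each coefficient of a greedy projection by its modulus multiplies the coefficients,
  taken in decreasing order of modulus, by increasing weights, so Abel summation expresses the
  sign vector through greedy projections with weights of bounded total variation. Bounding the
  difference from the \<open>\<alpha>\<close>-normalised projection makes the summation an induction: with \<open>\<alpha>\<close> equal
  to the least modulus, the least coordinate drops out of the difference, and decreasing \<open>\<alpha>\<close>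
  changes it by a multiple of the projection.
\<close>

lemma quasi_greedy_sign_difference:
  assumes bound: "\<And>m A. greedy_set f x m A \<Longrightarrow> norm (P A x) \<le> C * norm x"
    and "greedy_set f x m A" "\<alpha> > 0" "\<And>i. i \<in> A \<Longrightarrow> \<alpha> \<le> norm (f i x)" "C \<ge> 0"
  shows "norm (comb (\<lambda>i. f i x / of_real (norm (f i x))) A - (1 / \<alpha>) *\<^sub>R P A x) \<le> C * norm x / \<alpha>"
  using assms(2-4)
proof (induction m arbitrary: A \<alpha>)
  case 0
  then have "A = {}" by (auto simp: greedy_set_def)
  then show ?case using \<open>C \<ge> 0\<close> \<open>\<alpha> > 0\<close> by (simp add: signed_indicator_def coord_proj_def)
next
  case (Suc m)
  let ?u = "\<lambda>i. f i x / of_real (norm (f i x))"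
  have A: "finite A" "A \<noteq> {}" "A \<subseteq> {1..}" "card A = Suc m"
    using Suc.prems by (auto simp: greedy_set_def)
  obtain j where j: "j \<in> A" "\<And>i. i \<in> A \<Longrightarrow> norm (f j x) \<le> norm (f i x)"
    using ex_is_arg_min_if_finite[OF A(1,2), of "\<lambda>i. norm (f i x)"]
    by (auto simp: is_arg_min_linorder)
  define \<beta> where "\<beta> = norm (f j x)"
  have \<beta>: "\<alpha> \<le> \<beta>" "\<beta> > 0" using Suc.prems(2,3) j(1) by (force simp: \<beta>_def)+
  define A' where "A' = A - {j}"
  have "greedy_set f x m A'"
    using Suc.prems(1) j A unfolding greedy_set_def A'_def
    by (auto simp: card_Diff_singleton)
  then have IH: "norm (comb ?u A' - (1 / \<beta>) *\<^sub>R P A' x) \<le> C * norm x / \<beta>"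
    using j \<beta> by (intro Suc.IH) (auto simp: \<beta>_def A'_def)
  have split: "comb a A = smul (a j) (e j) + comb a A'" for a
    unfolding signed_indicator_def A'_def by (rule sum.remove[OF A(1) j(1)])
  have "smul (?u j) (e j) = (1 / \<beta>) *\<^sub>R smul (f j x) (e j)"
    by (simp add: scale_of_real[symmetric] \<beta>_def field_simps)
  then have "comb ?u A - (1 / \<beta>) *\<^sub>R P A x = comb ?u A' - (1 / \<beta>) *\<^sub>R P A' x"
    using split[of ?u] split[of "\<lambda>i. f i x"]
    by (simp add: proj_eq_comb scaleR_add_right)
  then have "comb ?u A - (1 / \<alpha>) *\<^sub>R P A x
      = (comb ?u A' - (1 / \<beta>) *\<^sub>R P A' x) - (1 / \<alpha> - 1 / \<beta>) *\<^sub>R P A x"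
    by (simp add: scaleR_diff_left algebra_simps)
  then have "norm (comb ?u A - (1 / \<alpha>) *\<^sub>R P A x)
      \<le> norm (comb ?u A' - (1 / \<beta>) *\<^sub>R P A' x) + norm ((1 / \<alpha> - 1 / \<beta>) *\<^sub>R P A x)"
    by (simp only: norm_triangle_ineq4)
  also have "norm ((1 / \<alpha> - 1 / \<beta>) *\<^sub>R P A x) = (1 / \<alpha> - 1 / \<beta>) * norm (P A x)"
    using \<beta> Suc.prems(2) by (simp add: frac_le)
  also have "(1 / \<alpha> - 1 / \<beta>) * norm (P A x) \<le> (1 / \<alpha> - 1 / \<beta>) * (C * norm x)"
    using \<beta> Suc.prems by (intro mult_left_mono bound) (auto simp: frac_le)
  finally show ?case using IH by (simp add: algebra_simps)
qed

lemma quasi_greedy_sign_bound: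
  assumes bound: "\<And>m A. greedy_set f x m A \<Longrightarrow> norm (P A x) \<le> C * norm x"
    and "greedy_set f x m A" "\<alpha> > 0" "\<And>i. i \<in> A \<Longrightarrow> \<alpha> \<le> norm (f i x)" "C \<ge> 0"
  shows "\<exists>\<delta>. is_sign \<delta> \<and> \<alpha> * norm (comb \<delta> A) \<le> 2 * C * norm x"
proof -
  \<comment> \<open>A sign has modulus 1 everywhere, hence the default value off \<open>A\<close>.\<close>
  let ?\<delta> = "\<lambda>i. if i \<in> A then f i x / of_real (norm (f i x)) else 1"
  have "f i x \<noteq> 0" if "i \<in> A" for i using assms(3) assms(4)[OF that] by auto
  then have "is_sign ?\<delta>"
    by (auto simp: is_sign_def norm_divide)
  moreover have "comb ?\<delta> A = comb (\<lambda>i. f i x / of_real (norm (f i x))) A" by (rule comb_cong) simp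
  then have d: "norm (comb ?\<delta> A - (1 / \<alpha>) *\<^sub>R P A x) \<le> C * norm x / \<alpha>"
    using quasi_greedy_sign_difference[OF assms] by simp
  have "norm ((1 / \<alpha>) *\<^sub>R P A x) \<le> C * norm x / \<alpha>"
    using bound[OF assms(2)] assms(3) by (simp add: divide_right_mono)
  with d have "norm (comb ?\<delta> A) \<le> 2 * (C * norm x / \<alpha>)"
    using norm_triangle_sub[of "comb ?\<delta> A" "(1 / \<alpha>) *\<^sub>R P A x"] by linarith
  then have "\<alpha> * norm (comb ?\<delta> A) \<le> \<alpha> * (2 * (C * norm x / \<alpha>))"
    using assms(3) by (intro mult_left_mono) auto
  then have "\<alpha> * norm (comb ?\<delta> A) \<le> 2 * C * norm x"
    using assms(3) by simp
  ultimately show ?thesis by blast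
qed

section \<open>Strong partial greediness\<close>

lemma quasi_greedy_of_strong_partially_greedy:
  assumes spg: "strong_partially_greedy smul e f s n"
    and s: "strict_mono_on {1..} s" "bounded_quotient_gaps s" "\<forall>k\<ge>1. s k \<ge> 1"
  shows "quasi_greedy smul e f"
proof -
  obtain C where "C \<ge> 1" and C: "\<And>x m A. m \<in> s ` {1..} \<Longrightarrow> greedy_set f x m A \<Longrightarrow>
      norm (x - P A x) \<le> C * sigma_hat smul e f n m x"
    using spg unfolding strong_partially_greedy_def by blast
  have exact: "norm (P A x) \<le> (1 + C) * norm x" if "t \<in> s ` {1..}" "greedy_set f x t A" for x t A
  proof -
    have "sigma_hat smul e f n t x \<le> norm (x - partial_sum smul e f n 0 x)"
      unfolding sigma_hat_def by (rule Min_le) auto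
    then have "sigma_hat smul e f n t x \<le> norm x" by (simp add: partial_sum_def)
    then have "C * sigma_hat smul e f n t x \<le> C * norm x"
      using \<open>C \<ge> 1\<close> by (intro mult_left_mono) auto
    then have "norm (x - P A x) \<le> C * norm x" using C[OF that] by linarith
    then show ?thesis
      using norm_triangle_sub[of "P A x" x] by (simp add: norm_minus_commute algebra_simps)
  qed
  obtain l where l: "\<And>k. k \<ge> 1 \<Longrightarrow> real (s (k + 1)) / real (s k) \<le> real l"
    using s(2) unfolding bounded_quotient_gaps_def by blast
  have gap: "s (k + 1) \<le> l * s k" if "k \<ge> 1" for k
  proof -
    have "s k > 0" using s(3) that by force
    then have "real (s (k + 1)) \<le> real (l * s k)"
      using l[OF that] by (simp add: divide_le_eq)
    then show ?thesis by linarith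
  qed
  obtain M where "M \<ge> 0" and M: "\<And>t x m A. t \<in> s ` {1..} \<Longrightarrow> greedy_set f x m A \<Longrightarrow> t \<le> m \<Longrightarrow>
      m \<le> Suc l * t \<Longrightarrow> norm (P A x) \<le> M * norm x"
    using greedy_proj_bound_multiples[of "s ` {1..}" "1 + C" l, OF exact] \<open>C \<ge> 1\<close> by force
  have "norm (P A x) \<le> (M + 2 * K * s 1) * norm x" if g: "greedy_set f x m A" for x m A
  proof (cases "m < s 1")
    case True
    have "norm (P A x) \<le> 2 * K * m * norm x"
      using norm_proj_le_card[of A x] g by (auto simp: greedy_set_def)
    also have "\<dots> \<le> (M + 2 * K * s 1) * norm x"
      using True \<open>M \<ge> 0\<close> K_ge_1 by (intro mult_right_mono add_increasing mult_left_mono) auto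
    finally show ?thesis .
  next
    case False
    have unbounded: "i < s (Suc i)" for i
    proof (induction i)
      case 0
      have "s 1 \<ge> 1" using s(3) by simp
      then show ?case by simp
    next
      case (Suc i)
      have "s (Suc i) < s (Suc (Suc i))" using s(1) by (auto simp: strict_mono_on_def)
      then show ?case using Suc by linarith
    qed
    \<comment> \<open>This is the index with \<open>s k \<le> m < s (k + 1)\<close>.\<close>
    define k where "k = (LEAST j. m < s (Suc j))"
    have k: "m < s (Suc k)" unfolding k_def by (rule LeastI) (rule unbounded)
    then have "k \<noteq> 0" using False by (intro notI) simp
    then have "s k \<le> m"
      using not_less_Least[of "k - 1" "\<lambda>j. m < s (Suc j)"] by (simp add: k_def[symmetric])
    moreover have "m \<le> Suc l * s k" using k gap[of k] \<open>k \<noteq> 0\<close> by simp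
    ultimately have "norm (P A x) \<le> M * norm x" using M[of "s k", OF _ g] \<open>k \<noteq> 0\<close> by simp
    also have "\<dots> \<le> (M + 2 * K * s 1) * norm x"
      using K_ge_1 by (intro mult_right_mono) auto
    finally show ?thesis .
  qed
  moreover have "M + 2 * K * s 1 > 0"
    using \<open>M \<ge> 0\<close> K_ge_1 s(3) by (intro add_nonneg_pos mult_pos_pos) (force simp: Suc_le_eq)+
  ultimately show ?thesis unfolding quasi_greedy_def by blast
qed

lemma partial_sum_eq_proj:
  assumes "strict_mono_on {1..} n"
  shows "partial_sum smul e f n k x = P (n ` {1..k}) x"
proof -
  have "inj_on n {1..k}"
    using assms by (meson atLeastAtMost_iff atLeast_iff inj_on_subset strict_mono_on_imp_inj_on subsetI)
  then show ?thesis by (simp add: partial_sum_def coord_proj_def sum.reindex)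
qed

lemma initial_terms:
  fixes n :: "nat \<Rightarrow> nat"
  assumes "strict_mono_on {1..} n" "\<forall>k\<ge>1. n k \<ge> 1"
  shows "finite (n ` {1..k})" "n ` {1..k} \<subseteq> {1..}" "card (n ` {1..k}) = k"
    and "t \<ge> 1 \<Longrightarrow> n ` {1..t} = {a \<in> n ` {1..}. a \<le> n t}"
proof -
  have inj: "inj_on n {1..}" using assms(1) by (rule strict_mono_on_imp_inj_on)
  show "finite (n ` {1..k})" by simp
  show "n ` {1..k} \<subseteq> {1..}" using assms(2) by auto
  have "inj_on n {1..k}" using inj by (rule inj_on_subset) auto
  then show "card (n ` {1..k}) = k" by (simp add: card_image)
  assume "t \<ge> 1"
  then have "n i \<le> n t \<longleftrightarrow> i \<le> t" if "i \<ge> 1" for i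
    using strict_mono_on_less_eq[OF assms(1), of i t] that by simp
  then show "n ` {1..t} = {a \<in> n ` {1..}. a \<le> n t}" by auto
qed

lemma order_superconservative_of_strong_partially_greedy:
  assumes spg: "strong_partially_greedy smul e f s n"
    and n: "strict_mono_on {1..} n" "\<forall>k\<ge>1. n k \<ge> 1"
    and s: "\<forall>k\<ge>1. s k \<ge> 1"
  shows "order_superconservative smul e s n"
proof -
  obtain C where "C \<ge> 1" and C: "\<And>x m A. m \<in> s ` {1..} \<Longrightarrow> greedy_set f x m A \<Longrightarrow>
      norm (x - P A x) \<le> C * sigma_hat smul e f n m x"
    using spg unfolding strong_partially_greedy_def by blast
  have "norm (comb \<epsilon> A) \<le> C * K * norm (comb \<delta> B)"
    if AB: "(A, B) \<in> T_pairs n s" and signs: "is_sign \<epsilon>" "is_sign \<delta>" for A B \<epsilon> \<delta>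
  proof -
    have A: "finite A" "A \<subseteq> {1..}" "A \<subseteq> n ` {1..}" and B: "finite B" "B \<subseteq> {1..}"
      and le: "card A \<le> card B" using AB by (auto simp: T_pairs_def)
    obtain t where t: "t \<in> s ` {1..}" "\<forall>a\<in>A. a \<le> n t" "\<forall>b\<in>B \<inter> n ` {1..}. n t < b"
      using AB by (auto simp: T_pairs_def)
    have "t \<ge> 1" using t(1) s by auto
    define D where "D = n ` {1..t}"
    have D: "finite D" "D \<subseteq> {1..}" "card D = t" "D = {a \<in> n ` {1..}. a \<le> n t}"
      unfolding D_def by (fact initial_terms(1-3)[OF n] initial_terms(4)[OF n \<open>t \<ge> 1\<close>])+
    have AD: "A \<subseteq> D" unfolding D(4) using A(3) t(2) by (simp add: subset_iff)
    have "b \<notin> D" if "b \<in> B" for b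
    proof
      assume "b \<in> D"
      then have "b \<in> {a \<in> n ` {1..}. a \<le> n t}" by (simp only: D(4)[symmetric])
      then have "b \<in> n ` {1..}" "b \<le> n t" by auto
      then have "n t < b" by (intro bspec[OF t(3)] IntI that)
      with \<open>b \<le> n t\<close> show False by simp
    qed
    then have BD: "B \<inter> D = {}" by blast
    obtain N where N: "card (B \<inter> {1..N}) = card A"
      using initial_segment_of_card[OF B le] by blast
    define B' where "B' = B \<inter> {1..N}"
    have B': "finite B'" "B' \<subseteq> {1..}" "B' \<inter> D = {}" using B BD by (auto simp: B'_def)
    define c where "c i = (if i \<in> A then \<epsilon> i else if i \<in> B' then \<delta> i else 1)" for i
    define y where "y = comb c (D \<union> B')"
    define G where "G = (D - A) \<union> B'"
    have fy: "f i y = (if i \<in> D \<union> B' then c i else 0)" if "i \<ge> 1" for i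
      unfolding y_def using D B' that by (intro coord_comb) auto
    have "norm (c i) = 1" if "i \<ge> 1" for i
      using signs that by (simp add: c_def is_sign_def)
    moreover have "card G = t"
    proof -
      have "card G = card (D - A) + card B'"
        unfolding G_def using D B' by (intro card_Un_disjoint) auto
      moreover have "card A \<le> t" using card_mono[OF D(1) AD] D(3) by simp
      ultimately show ?thesis
        using card_Diff_subset[OF A(1) AD] N D(3) by (simp add: B'_def)
    qed
    ultimately have "greedy_set f y t G"
      using D B' by (auto simp: greedy_set_def fy G_def subset_iff)
    from C[OF t(1) this] have greedy: "norm (y - P G y) \<le> C * sigma_hat smul e f n t y" .
    have "sigma_hat smul e f n t y \<le> norm (y - P D y)"
      unfolding sigma_hat_def D_def partial_sum_eq_proj[OF n(1)] by (rule Min_le) auto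
    then have "C * sigma_hat smul e f n t y \<le> C * norm (y - P D y)"
      using \<open>C \<ge> 1\<close> by (intro mult_left_mono) auto
    moreover have "y - P G y = comb c A"
    proof -
      have "D \<union> B' = A \<union> G" using AD by (auto simp: G_def)
      then have "y = comb c A + comb c G" unfolding y_def
        using A D B' AD by (subst comb_union[symmetric]) (auto simp: G_def)
      moreover have "P G y = comb c (G \<inter> (D \<union> B'))"
        unfolding y_def using D B' by (intro proj_comb) (auto simp: G_def)
      moreover have "G \<inter> (D \<union> B') = G" by (auto simp: G_def)
      ultimately show ?thesis by simp
    qed
    moreover have "y - P D y = comb c B'"
    proof -
      have "y = comb c D + comb c B'"
        unfolding y_def using D B' by (subst comb_union) auto
      moreover have "P D y = comb c D"
        unfolding y_def using D B' by (subst proj_comb) (auto simp: Int_absorb2)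
      ultimately show ?thesis by simp
    qed
    ultimately have "norm (comb c A) \<le> C * norm (comb c B')" using greedy by simp
    moreover have "comb c A = comb \<epsilon> A" by (rule comb_cong) (simp add: c_def)
    moreover have "comb c B' = comb \<delta> B'"
      by (rule comb_cong) (use B' AD in \<open>auto simp: c_def\<close>)
    moreover have initial: "norm (comb \<delta> B') \<le> K * norm (comb \<delta> B)"
      using schauder[of N "comb \<delta> B"] B by (simp add: proj_comb B'_def Int_commute subset_eq)
    moreover have "C * norm (comb \<delta> B') \<le> C * (K * norm (comb \<delta> B))"
      using initial \<open>C \<ge> 1\<close> by (intro mult_left_mono) auto
    ultimately show ?thesis by (simp add: mult.assoc)
  qed
  moreover have "C * K > 0" using \<open>C \<ge> 1\<close> K_ge_1 by simp
  ultimately show ?thesis unfolding order_superconservative_def by blast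
qed

lemma strong_partially_greedy_of_quasi_greedy:
  assumes qg: "quasi_greedy smul e f" and osc: "order_superconservative smul e s n"
    and ns: "n_schauder smul e f n"
    and n: "strict_mono_on {1..} n" "\<forall>k\<ge>1. n k \<ge> 1"
    and s: "\<forall>k\<ge>1. s k \<ge> 1"
  shows "strong_partially_greedy smul e f s n"
proof -
  obtain Q where "Q > 0" and Q0: "\<And>x m A. m \<ge> 1 \<Longrightarrow> greedy_set f x m A \<Longrightarrow>
      norm (P A x) \<le> Q * norm x"
    using qg unfolding quasi_greedy_def by blast
  have Q: "norm (P A x) \<le> Q * norm x" if "greedy_set f x m A" for x m A
  proof (cases "m \<ge> 1")
    case False
    then have "card A = 0" "finite A" using that by (auto simp: greedy_set_def)
    then have "A = {}" by simp
    then show ?thesis using \<open>Q > 0\<close> by (simp add: coord_proj_def)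
  qed (use Q0 that in blast)
  obtain S where "S > 0" and S: "\<And>A B \<epsilon> \<delta>. (A, B) \<in> T_pairs n s \<Longrightarrow> is_sign \<epsilon> \<Longrightarrow> is_sign \<delta> \<Longrightarrow>
      norm (comb \<epsilon> A) \<le> S * norm (comb \<delta> B)"
    using osc unfolding order_superconservative_def by blast
  obtain R where "R > 0" and R: "\<And>x m. m \<ge> 1 \<Longrightarrow> norm (partial_sum smul e f n m x) \<le> R * norm x"
    using ns unfolding n_schauder_def by blast
  define C where "C = 1 + Q + S * (2 * Q * (1 + R))"
  have main: "norm (x - P A x) \<le> C * norm (x - partial_sum smul e f n k x)"
    if m: "m \<in> s ` {1..}" and g: "greedy_set f x m A" and k: "k \<le> m" for x m A k
  proof -
    have "m \<ge> 1" using m s by auto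
    define D E where "D = n ` {1..k}" and "E = n ` {1..m}"
    have "D \<subseteq> E" unfolding D_def E_def using k by (intro image_mono) auto
    have D: "finite D" "D \<subseteq> {1..}"
      and E: "finite E" "E \<subseteq> {1..}" "card E = m"
      unfolding D_def E_def by (fact initial_terms(1-3)[OF n])+
    have E_iff: "a \<in> E \<longleftrightarrow> a \<in> n ` {1..} \<and> a \<le> n m" for a
      unfolding E_def initial_terms(4)[OF n \<open>m \<ge> 1\<close>] by (rule mem_Collect_eq)
    note D = D \<open>D \<subseteq> E\<close>
    have A: "finite A" "A \<subseteq> {1..}" "card A = m"
      and order: "\<And>i j. i \<in> A \<Longrightarrow> j \<ge> 1 \<Longrightarrow> j \<notin> A \<Longrightarrow> norm (f j x) \<le> norm (f i x)"
      using g by (auto simp: greedy_set_def)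
    define y z where "y = x - P D x" and "z = x - P E x"
    have "P (A - D) y = P (A - D) x"
      unfolding y_def using A D by (intro proj_remove) auto
    then have "norm (P (A - D) x) \<le> Q * norm y"
      using Q[OF greedy_set_remove[OF g D(1,2)]] by (simp add: y_def)
    have "norm z \<le> (1 + R) * norm y"
    proof -
      have "P E y = P E x - P D x"
        using D E by (simp add: y_def proj_diff proj_proj Int_absorb1)
      then have "z = y - P E y" by (simp add: y_def z_def)
      then have "norm z \<le> norm y + norm (P E y)" by (simp only: norm_triangle_ineq4)
      moreover have "norm (P E y) \<le> R * norm y"
        using R[OF \<open>m \<ge> 1\<close>, of y] by (simp only: partial_sum_eq_proj[OF n(1)] E_def)
      ultimately show ?thesis by (simp add: distrib_right)
    qed
    have gz: "greedy_set f z (card (A - E)) (A - E)"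
      unfolding z_def by (rule greedy_set_remove[OF g E(1,2)])
    have fz: "f i z = f i x" if "i \<in> A - E" for i
    proof -
      have "i \<ge> 1" using that A by auto
      then show ?thesis using that E by (simp add: z_def coord_linear coord_proj_coord)
    qed
    \<comment> \<open>Both \<open>E\<close> and \<open>A\<close> have \<open>m\<close> elements.\<close>
    have card_eq: "card (E - A) = card (A - E)"
      using A E by (simp add: card_Diff_subset_Int Int_commute)
    have "norm (P (D - A) x) \<le> S * (2 * Q * norm z)"
    proof (cases "\<exists>j\<in>D - A. f j x \<noteq> 0")
      case False
      then have "P (D - A) x = 0" by (simp add: coord_proj_def)
      then show ?thesis using \<open>S > 0\<close> \<open>Q > 0\<close> by simp
    next
      case True
      \<comment> \<open>As \<open>A\<close> is greedy, \<open>\<alpha>\<close> separates the moduli on \<open>D - A\<close> from those on \<open>A - E\<close>.\<close>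
      define \<alpha> where "\<alpha> = Max ((\<lambda>j. norm (f j x)) ` (D - A))"
      have \<alpha>: "norm (f j x) \<le> \<alpha>" if "j \<in> D - A" for j
        unfolding \<alpha>_def using D that by (intro Max_ge) auto
      have "\<alpha> > 0" using True \<alpha> by (meson less_le_trans zero_less_norm_iff)
      have "\<alpha> \<in> (\<lambda>j. norm (f j x)) ` (D - A)"
        unfolding \<alpha>_def using True D by (intro Max_in) auto
      then have "\<alpha> \<le> norm (f i z)" if "i \<in> A - E" for i
        using that D order[of i] fz[OF that] by auto
      then have "\<exists>\<delta>. is_sign \<delta> \<and> \<alpha> * norm (comb \<delta> (A - E)) \<le> 2 * Q * norm z"
        using gz \<open>\<alpha> > 0\<close> \<open>Q > 0\<close> by (intro quasi_greedy_sign_bound) (auto intro: Q)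
      then obtain \<delta> where \<delta>: "is_sign \<delta>" "\<alpha> * norm (comb \<delta> (A - E)) \<le> 2 * Q * norm z"
        by blast
      have "card (D - A) \<le> card (A - E)"
        unfolding card_eq[symmetric] using D E by (intro card_mono) auto
      then have "(D - A, A - E) \<in> T_pairs n s"
        unfolding T_pairs_def
      proof (intro CollectI case_prodI conjI bexI[of _ m] m)
        show "D - A \<subseteq> n ` {1..}" "\<forall>a\<in>D - A. a \<le> n m" using D(3) E_iff by blast+
        show "\<forall>b\<in>(A - E) \<inter> n ` {1..}. n m < b" using E_iff by (simp add: not_le)
      qed (use D A in auto)
      then have signs: "norm (comb \<epsilon> (D - A)) \<le> S * norm (comb \<delta> (A - E))"
        if "is_sign \<epsilon>" for \<epsilon> using that \<delta>(1) by (rule S)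
      have "norm (P (D - A) x) \<le> \<alpha> * (S * norm (comb \<delta> (A - E)))"
        unfolding proj_eq_comb
        by (rule norm_combination_le_signs) (use D(1) \<alpha> \<open>\<alpha> > 0\<close> signs in auto)
      also have "\<dots> \<le> S * (2 * Q * norm z)"
        using \<delta>(2) \<open>S > 0\<close> by (simp add: mult.left_commute)
      finally show ?thesis .
    qed
    also have "\<dots> \<le> S * (2 * Q * ((1 + R) * norm y))"
      using \<open>norm z \<le> _\<close> \<open>S > 0\<close> \<open>Q > 0\<close> by (intro mult_left_mono) auto
    finally have third: "norm (P (D - A) x) \<le> S * (2 * Q * (1 + R)) * norm y"
      by (simp add: mult.assoc)
    have "P D x + P (A - D) x = P A x + P (D - A) x"
    proof -
      have "D \<union> (A - D) = A \<union> (D - A)" by auto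
      then show ?thesis
        using proj_union[of D "A - D" x] proj_union[of A "D - A" x] A D by auto
    qed
    then have "x - P A x = y - P (A - D) x + P (D - A) x"
      by (simp add: y_def algebra_simps)
    then have "norm (x - P A x) \<le> norm y + norm (P (A - D) x) + norm (P (D - A) x)"
      using norm_triangle_ineq[of "y - P (A - D) x" "P (D - A) x"]
        norm_triangle_ineq4[of y "P (A - D) x"] by simp
    then have "norm (x - P A x) \<le> C * norm y"
      using third \<open>norm (P (A - D) x) \<le> _\<close> by (simp add: C_def distrib_right)
    then show ?thesis by (simp only: y_def D_def partial_sum_eq_proj[OF n(1)])
  qed
  have "norm (x - P A x) \<le> C * sigma_hat smul e f n m x"
    if "m \<in> s ` {1..}" "greedy_set f x m A" for x m A
  proof -
    have "sigma_hat smul e f n m x \<in> (\<lambda>k. norm (x - partial_sum smul e f n k x)) ` {0..m}"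
      unfolding sigma_hat_def by (rule Min_in) auto
    then show ?thesis using main[OF that] by auto
  qed
  moreover have "C \<ge> 1" using \<open>Q > 0\<close> \<open>S > 0\<close> \<open>R > 0\<close> by (simp add: C_def)
  ultimately show ?thesis unfolding strong_partially_greedy_def by blast
qed

end

theorem proposition7p16:
  fixes smul :: "'f::real_or_complex \<Rightarrow> 'a::banach \<Rightarrow> 'a"
    and e :: "nat \<Rightarrow> 'a" and f :: "nat \<Rightarrow> 'a \<Rightarrow> 'f"
    and n s :: "nat \<Rightarrow> nat"
  assumes "separable_inf_dim_banach smul"
    and "strict_mono_on {1..} n" and "\<forall>k\<ge>1. n k \<ge> 1"
    and "strict_mono_on {1..} s" and "\<forall>k\<ge>1. s k \<ge> 1"
    and "is_basis smul e f"
    and "schauder_basis smul e f"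
    and "n_schauder smul e f n"
    and "bounded_quotient_gaps s"
  shows "strong_partially_greedy smul e f s n \<longleftrightarrow>
           quasi_greedy smul e f \<and> order_superconservative smul e s n"
proof -
  obtain K where K: "\<And>x m. m \<ge> 1 \<Longrightarrow> norm (coord_proj smul e f {1..m} x) \<le> K * norm x"
    using assms(7) unfolding schauder_basis_def coord_proj_def by blast
  interpret separable_inf_dim_banach smul by (rule assms(1))
  interpret schauder_system smul e f "max 1 K"
  proof
    show "f k \<in> dual_space smul" if "k \<ge> 1" for k
      using assms(6) that by (simp add: is_basis_def)
    show "f j (e k) = (if j = k then 1 else 0)" if "j \<ge> 1" "k \<ge> 1" for j k
      using assms(6) that by (simp add: is_basis_def)
    show "norm (coord_proj smul e f {1..m} x) \<le> max 1 K * norm x" for m x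
    proof (cases "m \<ge> 1")
      case True
      have "K * norm x \<le> max 1 K * norm x" by (intro mult_right_mono) auto
      then show ?thesis using K[OF True, of x] by linarith
    qed (simp add: coord_proj_def)
  qed simp
  show ?thesis
    using quasi_greedy_of_strong_partially_greedy[OF _ assms(4,9,5)]
      order_superconservative_of_strong_partially_greedy[OF _ assms(2,3,5)]
      strong_partially_greedy_of_quasi_greedy[OF _ _ assms(8,2,3,5)]
    by blast
qed

end
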